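(* Let $f$ be analytic on the upper half plane and polynomially bounded in every vertical strip $\{\sigma_1\le\sigma\le\sigma_2,\ t\ge1\}$. Suppose that, for some $d\ge1$, its order function $\mu$ satisfies $$\mu(\sigma)=\mu(1-\sigma)+d\left(\tfrac12-\sigma\right)\quad(\sigma\in\mathbb{R}),\qquad \mu(\sigma)=0\quad(\sigma\ge1),$$ and that $\mu'(1/2)$ does not exist. Then $f$ satisfies the Lindelöf hypothesis if and only if the family $\sigma_p(\alpha)$ of $L^p$ abscissae of $f$ is approximately concave.
   Context: Write $s=\sigma+it$. "Polynomially bounded" in a strip means $|f(\sigma+it)|\le C t^{A}$ there for some constants $A,C$ (depending on the strip). Order function: $\mu(\sigma)=\inf\{\mu\ge 0: f(\sigma+it)\ll t^{\mu}\ (t\ge1)\}$, $\sigma\in\mathbb{R}$. By the Phragmén–Lindelöf theorem $\mu$ is convex, and here it is non-increasing. Let $b\le 1$ be the number with $\mu(\sigma)>0$ for $\sigma<b$ and $\mu(\sigma)=0$ for $\sigma\ge b$. The Lindelöf hypothesis for $f$ is the statement $b=1/2$. $L^p$ abscissae: given a real $a<1$ with $\mu(a)>0$, for real $p>0$ and $1<\alpha\le\mu(a)p$, $$\sigma_p(\alpha)=\inf\Big\{\sigma\in[a,1]: \Big(\int_1^\infty |f(\sigma+it)|^p\,\frac{dt}{t^\alpha}\Big)^{1/p}<\infty\Big\}.$$ Approximate concavity on the strip $a\le\sigma\le1$: for every $\varepsilon>0$ there is $P$ such that for all $q,r>0$, $\phi\in[0,1]$ with $p=\phi q+(1-\phi)r\ge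 P$, and all $\alpha$ with $1<\alpha\le\mu(a)\min(q,r)$, one has $\phi\,\sigma_q(\alpha)+(1-\phi)\,\sigma_r(\alpha)\le\sigma_p(\alpha)+\varepsilon$. For $f$ on the upper half plane, "approximately concave" means that this holds for every real $a<1$ with $\mu(a)>0$. *)

theory Defs
  imports "HOL-Analysis.Analysis"
begin

definition polynomially_bounded_in_strips :: "(complex \<Rightarrow> complex) \<Rightarrow> bool" where
  "polynomially_bounded_in_strips f \<longleftrightarrow>
     (\<forall>\<sigma>1 \<sigma>2. \<exists>C A. \<forall>\<sigma>\<in>{\<sigma>1..\<sigma>2}. \<forall>t\<ge>1. norm (f (Complex \<sigma> t)) \<le> C * t powr A)"

(* The infimum is over a nonempty set, bounded below by 0, whenever f is
   polynomially bounded in strips. *)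
definition order_function :: "(complex \<Rightarrow> complex) \<Rightarrow> real \<Rightarrow> real" where
  "order_function f \<sigma> =
     Inf {m. 0 \<le> m \<and> (\<exists>C. \<forall>t\<ge>1. norm (f (Complex \<sigma> t)) \<le> C * t powr m)}"

(* "b is the number with ...": at most one b satisfies this. *)
definition is_order_threshold :: "(complex \<Rightarrow> complex) \<Rightarrow> real \<Rightarrow> bool" where
  "is_order_threshold f b \<longleftrightarrow>
     b \<le> 1 \<and> (\<forall>\<sigma><b. order_function f \<sigma> > 0) \<and> (\<forall>\<sigma>\<ge>b. order_function f \<sigma> = 0)"

definition lindelof_hypothesis :: "(complex \<Rightarrow> complex) \<Rightarrow> bool" where
  "lindelof_hypothesis f \<longleftrightarrow> is_order_threshold f (1/2)"

(* Finiteness of the L^p norm is stated for its p-th power, which is the same for p > 0.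
   When the order function of f vanishes at 1, the set contains 1 for all p > 0 and
   alpha > 1, so the infimum is a genuine one. *)
definition Lp_abscissa ::
    "(complex \<Rightarrow> complex) \<Rightarrow> real \<Rightarrow> real \<Rightarrow> real \<Rightarrow> real" where
  "Lp_abscissa f a p \<alpha> =
     Inf {\<sigma>\<in>{a..1}.
       (\<integral>\<^sup>+t\<in>{1..}. ennreal (norm (f (Complex \<sigma> t)) powr p / t powr \<alpha>) \<partial>lborel) < \<infinity>}"

definition approx_concave_on_strip :: "(complex \<Rightarrow> complex) \<Rightarrow> real \<Rightarrow> bool" where
  "approx_concave_on_strip f a \<longleftrightarrow>
     (\<forall>\<epsilon>>0. \<exists>P. \<forall>q>0. \<forall>r>0. \<forall>\<phi>\<in>{0..1}. \<forall>\<alpha>.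
        \<phi> * q + (1 - \<phi>) * r \<ge> P \<longrightarrow>
        1 < \<alpha> \<longrightarrow> \<alpha> \<le> order_function f a * min q r \<longrightarrow>
        \<phi> * Lp_abscissa f a q \<alpha> + (1 - \<phi>) * Lp_abscissa f a r \<alpha>
          \<le> Lp_abscissa f a (\<phi> * q + (1 - \<phi>) * r) \<alpha> + \<epsilon>)"

definition approx_concave :: "(complex \<Rightarrow> complex) \<Rightarrow> bool" where
  "approx_concave f \<longleftrightarrow>
     (\<forall>a<1. order_function f a > 0 \<longrightarrow> approx_concave_on_strip f a)"

end

theory Submission
  imports Defs "HOL-Complex_Analysis.Complex_Analysis" "HOL-Real_Asymp.Real_Asymp"
begin

text \<open>Cauchy's formula on the rectangle \<open>[\<sigma>0, \<sigma>1] \<times> [T/2, 3T/2]\<close> with the kernel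
  \<open>exp ((w - s)\<^sup>2) T\<^bsup>c (w - s)\<^esup> / (w - s)\<close> bounds \<open>f (\<sigma> + iT)\<close> by Gaussian means of \<open>\<bar>f\<bar>\<close> on the two
  vertical sides. It yields both the convexity of \<open>\<mu>\<close> and the fact that finiteness of the \<open>L\<^sup>p\<close> integral on a
  line forces \<open>\<mu> \<le> \<alpha>/p\<close> to its right; conversely \<open>\<mu>(\<sigma>) < (\<alpha> - 1)/p\<close> makes the integral finite. So, up to
  \<open>O(1/p)\<close> in the argument, \<open>\<sigma>\<^sub>p(\<alpha>)\<close> is the inverse function of \<open>\<mu>\<close> at \<open>\<alpha>/p\<close>.

  Under the Lindeloef hypothesis this inverse is \<open>1/2 - \<alpha>/(d p)\<close>, which is concave in \<open>p\<close>. In the other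
  direction, letting \<open>p \<rightarrow> \<infinity>\<close> with \<open>\<alpha>/p\<close> fixed turns approximate concavity into midpoint convexity of \<open>1/\<mu>\<close>
  where \<open>\<mu> > 0\<close>. If \<open>\<mu>(1/2) > 0\<close>, then convexity of \<open>\<mu>\<close> and of \<open>1/\<mu>\<close> at \<open>1/2\<close>, combined with
  the functional equation, pin both one-sided slopes of \<open>\<mu>\<close> at \<open>1/2\<close> to \<open>-d/2\<close>, contradicting the
  non-existence of \<open>\<mu>'(1/2)\<close>.\<close>

section \<open>Cauchy's formula on a rectangle\<close>

text \<open>Cauchy's formula for \<open>G\<close> at a point of mid-height \<open>T\<close>. The
  kernel \<open>1 / (w - s)\<close> is at most the reciprocal horizontal distance on the vertical
  sides and at most 1 on the horizontal ones, which lie \<open>T/2 \<ge> 1\<close> away.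
  \<open>B\<close> is needed only on the horizontal sides; the decay built into \<open>G\<close>
  later makes it independent of \<open>T\<close>.\<close>

lemma rectangle_bound:
  fixes G :: "complex \<Rightarrow> complex"
  assumes hol: "G holomorphic_on {z. Im z > 0}" and \<sigma>: "\<sigma>0 < \<sigma>" "\<sigma> < \<sigma>1" and T: "T \<ge> 2"
    and B: "B \<ge> 0" "\<And>x t. x \<in> {\<sigma>0..\<sigma>1} \<Longrightarrow> t \<in> {T/2, 3*T/2} \<Longrightarrow> norm (G (Complex x t)) \<le> B"
  shows "2 * pi * norm (G (Complex \<sigma> T)) \<le>
           integral {T/2..3*T/2} (\<lambda>t. norm (G (Complex \<sigma>0 t))) / (\<sigma> - \<sigma>0) +
           integral {T/2..3*T/2} (\<lambda>t. norm (G (Complex \<sigma>1 t))) / (\<sigma>1 - \<sigma>) +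
           2 * B * (\<sigma>1 - \<sigma>0)"
proof -
  define s where "s = Complex \<sigma> T"
  define z1 z2 z3 z4 where "z1 = Complex \<sigma>0 (T/2)" and "z2 = Complex \<sigma>1 (T/2)"
    and "z3 = Complex \<sigma>1 (3*T/2)" and "z4 = Complex \<sigma>0 (3*T/2)"
  note z_defs = z1_def z2_def z3_def z4_def
  define F where "F = (\<lambda>w. G w / (w - s))"
  have op: "open {z. Im z > 0}"
    by (rule open_halfspace_Im_gt)
  have s_box: "s \<in> box z1 z3"
    using \<sigma> T by (auto simp: s_def z_defs in_box_complex_iff)
  have cont: "continuous_on {z. Im z > 0} G"
    using hol by (rule holomorphic_on_imp_continuous_on)
  have "(F has_contour_integral (2*pi * \<i> * winding_number (rectpath z1 z3) s * G s)) (rectpath z1 z3)"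
    unfolding F_def
  proof (rule Cauchy_integral_formula_convex_simple[where S = "{z. Im z > 0}"])
    show "convex {z. Im z > 0}"
      by (rule convex_halfspace_Im_gt)
    show "s \<in> interior {z. Im z > 0}"
      using T op by (simp add: interior_open s_def)
    show "path_image (rectpath z1 z3) \<subseteq> {z. Im z > 0} - {s}"
      using \<sigma> T by (auto simp: path_image_rectpath z_defs s_def)
  qed (use hol in auto)
  hence int: "(F has_contour_integral (2*pi * \<i> * G s)) (rectpath z1 z3)"
    using winding_number_rectpath[OF s_box] by simp
  have rect: "rectpath z1 z3 = linepath z1 z2 +++ linepath z2 z3 +++ linepath z3 z4 +++ linepath z4 z1"
    by (simp add: rectpath_def Let_def z_defs)
  from int have ints: "F contour_integrable_on linepath z1 z2" "F contour_integrable_on linepath z2 z3"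
      "F contour_integrable_on linepath z3 z4" "F contour_integrable_on linepath z4 z1"
    using has_contour_integral_integrable[OF int] unfolding rect by simp_all
  have eq: "2*pi * \<i> * G s = contour_integral (linepath z1 z2) F + contour_integral (linepath z2 z3) F
      + contour_integral (linepath z3 z4) F + contour_integral (linepath z4 z1) F"
    using contour_integral_unique[OF int] ints unfolding rect by (simp add: add_ac)
  have vertical: "norm (integral {T/2..3*T/2} (\<lambda>t. F (Complex x t)))
      \<le> integral {T/2..3*T/2} (\<lambda>t. norm (G (Complex x t))) / \<bar>x - \<sigma>\<bar>" if "x \<noteq> \<sigma>" for x
  proof -
    have c: "continuous_on {T/2..3*T/2} (\<lambda>t. G (Complex x t))"
      by (rule continuous_on_compose2[OF cont]) (use T in \<open>auto simp: Complex_eq intro!: continuous_intros\<close>)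
    have c': "continuous_on {T/2..3*T/2} (\<lambda>t. F (Complex x t))"
      unfolding F_def using that
      by (intro continuous_intros c) (auto simp: s_def Complex_eq complex_eq_iff intro!: continuous_intros)
    have "norm (integral {T/2..3*T/2} (\<lambda>t. F (Complex x t))) \<le>
          integral {T/2..3*T/2} (\<lambda>t. norm (G (Complex x t)) / \<bar>x - \<sigma>\<bar>)"
    proof (rule integral_norm_bound_integral)
      fix t
      have "\<bar>x - \<sigma>\<bar> \<le> norm (Complex x t - s)"
        using abs_Re_le_cmod[of "Complex x t - s"] by (simp add: s_def)
      thus "norm (F (Complex x t)) \<le> norm (G (Complex x t)) / \<bar>x - \<sigma>\<bar>"
        unfolding F_def norm_divide using that by (intro divide_left_mono mult_pos_pos) auto
    qed (use that in \<open>auto intro!: integrable_continuous_real c' continuous_intros c\<close>)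
    also have "\<dots> = integral {T/2..3*T/2} (\<lambda>t. norm (G (Complex x t))) / \<bar>x - \<sigma>\<bar>"
      by simp
    finally show ?thesis .
  qed
  have right: "norm (contour_integral (linepath z2 z3) F)
      \<le> integral {T/2..3*T/2} (\<lambda>t. norm (G (Complex \<sigma>1 t))) / (\<sigma>1 - \<sigma>)"
    using vertical[of \<sigma>1] \<sigma> T
    by (subst contour_integral_linepath_same_Re[where c = \<sigma>1 and a = "T/2" and b = "3*T/2"])
       (auto simp: z_defs norm_mult)
  \<comment> \<open>The left side is traversed downwards; reversing it gives an integral over
    increasing \<open>t\<close>.\<close>
  have "contour_integral (linepath z4 z1) F = - contour_integral (linepath z1 z4) F"
    by (metis contour_integral_reversepath reversepath_linepath valid_path_linepath)
  hence left: "norm (contour_integral (linepath z4 z1) F)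
      \<le> integral {T/2..3*T/2} (\<lambda>t. norm (G (Complex \<sigma>0 t))) / (\<sigma> - \<sigma>0)"
    using vertical[of \<sigma>0] \<sigma> T
    by (subst (asm) contour_integral_linepath_same_Re[where c = \<sigma>0 and a = "T/2" and b = "3*T/2"])
       (auto simp: z_defs norm_mult)
  have F_le: "norm (F (Complex x t)) \<le> B" if "x \<in> {\<sigma>0..\<sigma>1}" "t \<in> {T/2, 3*T/2}" for x t
  proof -
    have "1 \<le> \<bar>t - T\<bar>" using that T by auto
    also have "\<bar>t - T\<bar> \<le> norm (Complex x t - s)"
      using abs_Im_le_cmod[of "Complex x t - s"] by (simp add: s_def)
    finally have "norm (G (Complex x t)) / norm (Complex x t - s) \<le> norm (G (Complex x t))"
      by (simp add: divide_le_eq mult_left_le mult_le_cancel_left1)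
    thus ?thesis using B(2)[OF that] by (simp add: F_def norm_divide)
  qed
  \<comment> \<open>The top side runs from right to left, so the endpoints \<open>u\<close> and
    \<open>v\<close> may come in either order.\<close>
  have seg: "\<exists>x. x \<in> {\<sigma>0..\<sigma>1} \<and> w = Complex x t"
    if "w \<in> closed_segment (Complex u t) (Complex v t)" "u \<in> {\<sigma>0..\<sigma>1}" "v \<in> {\<sigma>0..\<sigma>1}" for w u v t
    using that by (intro exI[of _ "Re w"])
      (auto simp: closed_segment_same_Im closed_segment_eq_real_ivl complex_eq_iff split: if_splits)
  have bottom: "norm (contour_integral (linepath z1 z2) F) \<le> B * (\<sigma>1 - \<sigma>0)"
    using contour_integral_bound_linepath[OF ints(1) B(1)] seg[of _ \<sigma>0 "T/2" \<sigma>1] F_le \<sigma>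
    by (force simp: z_defs cmod_def)
  have top: "norm (contour_integral (linepath z3 z4) F) \<le> B * (\<sigma>1 - \<sigma>0)"
    using contour_integral_bound_linepath[OF ints(3) B(1)] seg[of _ \<sigma>1 "3*T/2" \<sigma>0] F_le \<sigma>
    by (force simp: z_defs cmod_def)
  have "2 * pi * norm (G s) = norm (2*pi * \<i> * G s)"
    by (simp add: norm_mult)
  also have "\<dots> \<le> norm (contour_integral (linepath z1 z2) F) + norm (contour_integral (linepath z2 z3) F)
      + norm (contour_integral (linepath z3 z4) F) + norm (contour_integral (linepath z4 z1) F)"
    unfolding eq by (intro order.trans[OF norm_triangle_ineq] add_mono order_refl)
  finally show ?thesis
    using left right bottom top by (simp add: s_def)
qed

section \<open>Elementary properties of the order function\<close>

lemma order_function_le: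
  assumes "0 \<le> m" "\<And>t. t \<ge> 1 \<Longrightarrow> norm (f (Complex \<sigma> t)) \<le> C * t powr m"
  shows "order_function f \<sigma> \<le> m"
  unfolding order_function_def using assms by (intro cInf_lower) (auto intro: bdd_belowI[of _ 0])

text \<open>The infimum need not be attained, so a power bound is available only for exponents
  strictly above it.\<close>

lemma order_function_bound:
  assumes poly: "polynomially_bounded_in_strips f" and m: "order_function f \<sigma> < m"
  obtains C where "C \<ge> 0" "\<And>t. t \<ge> 1 \<Longrightarrow> norm (f (Complex \<sigma> t)) \<le> C * t powr m"
proof -
  define S where "S = {m. 0 \<le> m \<and> (\<exists>C. \<forall>t\<ge>1. norm (f (Complex \<sigma> t)) \<le> C * t powr m)}"
  from poly obtain C A where CA: "\<And>t. t \<ge> 1 \<Longrightarrow> norm (f (Complex \<sigma> t)) \<le> C * t powr A"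
    unfolding polynomially_bounded_in_strips_def by (metis atLeastAtMost_iff order.refl)
  have "C \<ge> 0" using order.trans[OF norm_ge_zero CA[of 1]] by simp
  \<comment> \<open>\<open>A\<close> may be negative, whereas the infimum ranges over nonnegative
    exponents.\<close>
  have "\<bar>A\<bar> \<in> S"
    unfolding S_def using \<open>C \<ge> 0\<close>
    by (auto intro!: exI[of _ C] order.trans[OF CA] mult_left_mono powr_mono)
  hence "S \<noteq> {}" by auto
  moreover have "Inf S < m" using m by (simp add: order_function_def S_def)
  ultimately obtain m' where m': "m' \<in> S" "m' < m"
    using cInf_lessD by blast
  then obtain C' where C': "\<And>t. t \<ge> 1 \<Longrightarrow> norm (f (Complex \<sigma> t)) \<le> C' * t powr m'"
    by (auto simp: S_def)
  have "C' \<ge> 0" using order.trans[OF norm_ge_zero C'[of 1]] by simp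
  with m' have "norm (f (Complex \<sigma> t)) \<le> C' * t powr m" if "t \<ge> 1" for t
    using that by (auto intro!: order.trans[OF C'] mult_left_mono powr_mono)
  with \<open>C' \<ge> 0\<close> show ?thesis by (rule that)
qed

lemma order_function_nonneg:
  assumes poly: "polynomially_bounded_in_strips f"
  shows "order_function f \<sigma> \<ge> 0"
proof (rule ccontr)
  define S where "S = {m. 0 \<le> m \<and> (\<exists>C. \<forall>t\<ge>1. norm (f (Complex \<sigma> t)) \<le> C * t powr m)}"
  assume "\<not> order_function f \<sigma> \<ge> 0"
  hence "Inf S < 0" by (simp add: order_function_def S_def)
  \<comment> \<open>Nonnegativity of the members of \<open>S\<close> bounds \<open>Inf S\<close>
    only when \<open>S\<close> is nonempty.\<close>
  moreover have "S \<noteq> {}"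
  proof -
    have "order_function f \<sigma> < \<bar>order_function f \<sigma>\<bar> + 1" by simp
    then obtain C where "\<And>t. t \<ge> 1 \<Longrightarrow> norm (f (Complex \<sigma> t)) \<le> C * t powr (\<bar>order_function f \<sigma>\<bar> + 1)"
      using order_function_bound[OF poly] by metis
    hence "\<bar>order_function f \<sigma>\<bar> + 1 \<in> S" by (auto simp: S_def)
    thus ?thesis by auto
  qed
  ultimately obtain m where "m \<in> S" "m < 0" using cInf_lessD by blast
  thus False by (simp add: S_def)
qed

text \<open>Estimates on the window from \<open>T/2\<close> to \<open>3*T/2\<close> require
  \<open>T \<ge> 2\<close> to stay in \<open>t \<ge> 1\<close>. The remaining bounded range
  \<open>1 \<le> t < 2\<close> only enlarges the constant.\<close>

lemma order_function_le_from_2: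
  assumes poly: "polynomially_bounded_in_strips f" and "0 \<le> m"
    and C: "\<And>t. t \<ge> 2 \<Longrightarrow> norm (f (Complex \<sigma> t)) \<le> C * t powr m"
  shows "order_function f \<sigma> \<le> m"
proof -
  define n where n: "n = \<bar>order_function f \<sigma>\<bar> + 1"
  have "order_function f \<sigma> < n" by (simp add: n)
  then obtain D where D: "D \<ge> 0"
    and Dn: "\<And>t. t \<ge> 1 \<Longrightarrow> norm (f (Complex \<sigma> t)) \<le> D * t powr n"
    using order_function_bound[OF poly] by metis
  define K where "K = \<bar>C\<bar> + D * 2 powr n"
  have "norm (f (Complex \<sigma> t)) \<le> K * t powr m" if "t \<ge> 1" for t
  proof (cases "t \<ge> 2")
    case True
    have "C * t powr m \<le> K * t powr m"
      unfolding K_def using D by (intro mult_right_mono) (auto intro: order.trans[OF abs_ge_self])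
    with C[OF True] show ?thesis by linarith
  next
    case False
    have "norm (f (Complex \<sigma> t)) \<le> D * t powr n" by (rule Dn[OF that])
    also have "\<dots> \<le> D * 2 powr n"
      using False that D n by (intro mult_left_mono powr_mono2) auto
    also have "\<dots> \<le> K * 1" by (simp add: K_def)
    also have "\<dots> \<le> K * t powr m"
      using D that \<open>0 \<le> m\<close> by (intro mult_left_mono) (auto simp: K_def ge_one_powr_ge_zero)
    finally show ?thesis .
  qed
  with \<open>0 \<le> m\<close> show ?thesis by (rule order_function_le)
qed

section \<open>Gaussian means on vertical lines\<close>

text \<open>The weight is the \<open>t\<close>-dependent part of the modulus of
  \<open>exp ((w - s)\<^sup>2)\<close> on a vertical line, where \<open>s\<close> has height
  \<open>T\<close>. The mean is not normalised.\<close>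

definition gaussian_mean :: "(complex \<Rightarrow> complex) \<Rightarrow> real \<Rightarrow> real \<Rightarrow> real" where
  "gaussian_mean f \<sigma> T = integral {T/2..3*T/2} (\<lambda>t. norm (f (Complex \<sigma> t)) * exp (-(t - T)\<^sup>2))"

text \<open>Since \<open>1 + u\<^sup>2 \<le> exp (u\<^sup>2)\<close>, the Gaussian lies below the
  derivative of \<open>arctan\<close>. What matters is that the bound is uniform in
  \<open>a\<close>, \<open>b\<close> and \<open>T\<close>.\<close>

lemma gaussian_integral_le_pi: "integral {a..b} (\<lambda>t::real. exp (-(t - T)\<^sup>2)) \<le> pi"
proof (cases "a \<le> b")
  case True
  have int: "((\<lambda>t. inverse (1 + (t - T)\<^sup>2)) has_integral (arctan (b - T) - arctan (a - T))) {a..b}"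
    by (intro fundamental_theorem_of_calculus True)
       (auto intro!: derivative_eq_intros simp: has_real_derivative_iff_has_vector_derivative[symmetric])
  have "integral {a..b} (\<lambda>t. exp (-(t - T)\<^sup>2)) \<le> integral {a..b} (\<lambda>t. inverse (1 + (t - T)\<^sup>2))"
  proof (rule integral_le)
    fix t
    have "1 + (t - T)\<^sup>2 \<le> exp ((t - T)\<^sup>2)" by (rule exp_ge_add_one_self)
    moreover have "0 < 1 + (t - T)\<^sup>2" by (simp add: add_pos_nonneg)
    ultimately show "exp (-(t - T)\<^sup>2) \<le> inverse (1 + (t - T)\<^sup>2)"
      unfolding exp_minus by (rule le_imp_inverse_le)
  qed (intro integrable_continuous_real continuous_intros has_integral_integrable[OF int])+
  also have "\<dots> = arctan (b - T) - arctan (a - T)"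
    using int by (rule integral_unique)
  also have "\<dots> \<le> pi"
    using arctan_bounded[of "b - T"] arctan_bounded[of "a - T"] by linarith
  finally show ?thesis .
qed auto

text \<open>A Gaussian at distance \<open>T/2\<close> beats every power of \<open>T\<close>: combine
  \<open>ln T \<le> T\<close> with the square \<open>(T/2 - \<bar>B\<bar>)\<^sup>2 \<ge> 0\<close>.
  This controls the horizontal sides.\<close>

lemma powr_gaussian_le:
  fixes T B :: real
  assumes "T \<ge> 1"
  shows "T powr B * exp (-(T/2)\<^sup>2) \<le> exp (B\<^sup>2)"
proof -
  have "B * ln T \<le> \<bar>B\<bar> * T"
    using assms ln_bound[of T] by (intro mult_mono) auto
  also have "\<dots> \<le> (T/2)\<^sup>2 + B\<^sup>2"
    using zero_le_power2[of "T/2 - \<bar>B\<bar>"] by (simp add: power2_eq_square algebra_simps)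
  finally show ?thesis using assms by (simp add: powr_def flip: exp_add)
qed

lemma gaussian_mean_nonneg: "gaussian_mean f \<sigma> T \<ge> 0"
proof (cases "(\<lambda>t. norm (f (Complex \<sigma> t)) * exp (-(t - T)\<^sup>2)) integrable_on {T/2..3*T/2}")
  case True
  thus ?thesis unfolding gaussian_mean_def by (rule integral_nonneg) simp
next
  case False
  thus ?thesis by (simp add: gaussian_mean_def not_integrable_integral)
qed

section \<open>Interpolation between two vertical lines\<close>

text \<open>A three-lines argument: a factor \<open>T powr (c * (x - \<sigma>))\<close> equalises
  the powers of \<open>T\<close> on the two vertical sides. Hypotheses on means instead of pointwise
  bounds let the same lemma serve both for convexity and for integrals of p-th powers.\<close>

lemma order_function_le_interpolation:
  assumes hol: "f holomorphic_on {z. Im z > 0}" and poly: "polynomially_bounded_in_strips f"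
    and \<sigma>: "\<sigma>0 < \<sigma>" "\<sigma> < \<sigma>1"
    and mean0: "\<And>T. T \<ge> 2 \<Longrightarrow> gaussian_mean f \<sigma>0 T \<le> C0 * T powr m0"
    and mean1: "\<And>T. T \<ge> 2 \<Longrightarrow> gaussian_mean f \<sigma>1 T \<le> C1 * T powr m1"
    and m: "m = ((\<sigma>1 - \<sigma>) * m0 + (\<sigma> - \<sigma>0) * m1) / (\<sigma>1 - \<sigma>0)" "0 \<le> m"
  shows "order_function f \<sigma> \<le> m"
proof -
  obtain C A where CA: "\<And>x t. x \<in> {\<sigma>0..\<sigma>1} \<Longrightarrow> t \<ge> 1 \<Longrightarrow> norm (f (Complex x t)) \<le> C * t powr A"
    using poly unfolding polynomially_bounded_in_strips_def by metis
  have "C \<ge> 0" using order.trans[OF norm_ge_zero CA[of \<sigma>0 1]] \<sigma> by simp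
  \<comment> \<open>The slope that raises or lowers both exponents \<open>m0\<close> and
    \<open>m1\<close> to the interpolated value \<open>m\<close>.\<close>
  define c where "c = (m0 - m1) / (\<sigma>1 - \<sigma>0)"
  have c: "m0 + c * (\<sigma>0 - \<sigma>) = m" "m1 + c * (\<sigma>1 - \<sigma>) = m"
    using \<sigma> unfolding c_def m(1) by (simp_all add: field_simps)
  define D where "D = (\<sigma>1 - \<sigma>0)\<^sup>2"
  \<comment> \<open>The total power of \<open>T\<close> on a horizontal side:
    \<open>\<bar>A\<bar>\<close> from \<open>f\<close> and the rest from the linear term of the
    exponent. \<open>B\<close> is what remains after the Gaussian has absorbed it.\<close>
  define N where "N = \<bar>A\<bar> + \<bar>c\<bar> * (\<sigma>1 - \<sigma>0)"
  define B where "B = C * 2 powr \<bar>A\<bar> * exp D * exp (N\<^sup>2)"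
  define K where "K = exp D * C0 / (\<sigma> - \<sigma>0) + exp D * C1 / (\<sigma>1 - \<sigma>) + 2 * B * (\<sigma>1 - \<sigma>0)"
  have "B \<ge> 0" using \<open>C \<ge> 0\<close> by (simp add: B_def)
  have "norm (f (Complex \<sigma> T)) \<le> K / (2 * pi) * T powr m" if T: "T \<ge> 2" for T
  proof -
    define s where "s = Complex \<sigma> T"
    \<comment> \<open>The quadratic term gives decay in the imaginary direction, the linear one is
      the power of \<open>T\<close> with exponent \<open>c * (w - s)\<close>. Both vanish at
      \<open>s\<close>, so \<open>G s = f s\<close>.\<close>
    define G where "G = (\<lambda>w. f w * exp ((w - s)\<^sup>2 + of_real (c * ln T) * (w - s)))"
    have G_norm: "norm (G (Complex x t)) =
        exp ((x - \<sigma>)\<^sup>2) * T powr (c * (x - \<sigma>)) * (norm (f (Complex x t)) * exp (-(t - T)\<^sup>2))" for x t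
    proof -
      have Re_eq: "Re ((Complex x t - s)\<^sup>2 + of_real (c * ln T) * (Complex x t - s)) =
            (x - \<sigma>)\<^sup>2 + c * (x - \<sigma>) * ln T + (-(t - T)\<^sup>2)"
        by (simp add: s_def power2_eq_square)
      show ?thesis
        unfolding G_def norm_mult norm_exp_eq_Re unfolding Re_eq exp_add using T by (simp add: powr_def mult_ac)
    qed
    have D_le: "exp ((x - \<sigma>)\<^sup>2) \<le> exp D" if "x \<in> {\<sigma>0..\<sigma>1}" for x
      using that \<sigma> unfolding D_def by (subst exp_le_cancel_iff, subst abs_le_square_iff[symmetric]) auto
    have mean: "integral {T/2..3*T/2} (\<lambda>t. norm (G (Complex x t))) \<le> exp D * C' * T powr m"
      if "x \<in> {\<sigma>0..\<sigma>1}" "gaussian_mean f x T \<le> C' * T powr m'" "m' + c * (x - \<sigma>) = m" for x C' m'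
    proof -
      have "integral {T/2..3*T/2} (\<lambda>t. norm (G (Complex x t))) =
            exp ((x - \<sigma>)\<^sup>2) * T powr (c * (x - \<sigma>)) * gaussian_mean f x T"
        by (simp add: G_norm gaussian_mean_def)
      also have "\<dots> \<le> exp D * T powr (c * (x - \<sigma>)) * (C' * T powr m')"
        using that D_le[of x] by (intro mult_mono gaussian_mean_nonneg) auto
      also have "\<dots> = exp D * C' * T powr (m' + c * (x - \<sigma>))"
        by (simp add: powr_add)
      finally show ?thesis using that by simp
    qed
    have horiz: "norm (G (Complex x t)) \<le> B" if x: "x \<in> {\<sigma>0..\<sigma>1}" and t: "t \<in> {T/2, 3*T/2}" for x t
    proof -
      have t1: "t \<ge> 1" "t \<le> 2 * T" using t T by auto
      have "norm (f (Complex x t)) \<le> C * t powr A" by (rule CA[OF x t1(1)])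
      also have "\<dots> \<le> C * t powr \<bar>A\<bar>"
        using t1 \<open>C \<ge> 0\<close> by (intro mult_left_mono powr_mono) auto
      also have "\<dots> \<le> C * (2 * T) powr \<bar>A\<bar>"
        using t1 \<open>C \<ge> 0\<close> by (intro mult_left_mono powr_mono2) auto
      finally have f_le: "norm (f (Complex x t)) \<le> C * 2 powr \<bar>A\<bar> * T powr \<bar>A\<bar>"
        using T by (simp add: powr_mult)
      have "c * (x - \<sigma>) \<le> \<bar>c\<bar> * \<bar>x - \<sigma>\<bar>" by (metis abs_ge_self abs_mult)
      also have "\<dots> \<le> \<bar>c\<bar> * (\<sigma>1 - \<sigma>0)" using x \<sigma> by (intro mult_left_mono) auto
      finally have c_le: "T powr (c * (x - \<sigma>)) \<le> T powr (\<bar>c\<bar> * (\<sigma>1 - \<sigma>0))"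
        using T by (intro powr_mono) auto
      have "t - T = T/2 \<or> t - T = -(T/2)" using t by auto
      hence tT: "(t - T)\<^sup>2 = (T/2)\<^sup>2" by (metis power2_minus)
      have "norm (G (Complex x t)) \<le> exp D * T powr (\<bar>c\<bar> * (\<sigma>1 - \<sigma>0)) *
          (C * 2 powr \<bar>A\<bar> * T powr \<bar>A\<bar> * exp (-(T/2)\<^sup>2))"
        unfolding G_norm tT using \<open>C \<ge> 0\<close>
        by (intro mult_mono D_le x c_le f_le order_refl) auto
      also have "\<dots> = C * 2 powr \<bar>A\<bar> * exp D * (T powr N * exp (-(T/2)\<^sup>2))"
        by (simp add: N_def powr_add)
      also have "\<dots> \<le> B"
        unfolding B_def using T \<open>C \<ge> 0\<close> by (intro mult_left_mono powr_gaussian_le) auto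
      finally show ?thesis .
    qed
    have "G holomorphic_on {z. Im z > 0}"
      unfolding G_def by (intro holomorphic_intros hol)
    from rectangle_bound[OF this \<sigma> T \<open>B \<ge> 0\<close> horiz]
    have "2 * pi * norm (f (Complex \<sigma> T)) \<le>
           integral {T/2..3*T/2} (\<lambda>t. norm (G (Complex \<sigma>0 t))) / (\<sigma> - \<sigma>0) +
           integral {T/2..3*T/2} (\<lambda>t. norm (G (Complex \<sigma>1 t))) / (\<sigma>1 - \<sigma>) +
           2 * B * (\<sigma>1 - \<sigma>0)"
      using T by (simp add: G_norm)
    also have "\<dots> \<le> exp D * C0 * T powr m / (\<sigma> - \<sigma>0) + exp D * C1 * T powr m / (\<sigma>1 - \<sigma>) +
        2 * B * (\<sigma>1 - \<sigma>0) * T powr m"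
    proof (intro add_mono divide_right_mono)
      \<comment> \<open>The horizontal sides contribute a constant, which is absorbed because
        \<open>m \<ge> 0\<close>.\<close>
      have "1 \<le> T powr m" using T m by (simp add: ge_one_powr_ge_zero)
      hence "2 * B * (\<sigma>1 - \<sigma>0) * 1 \<le> 2 * B * (\<sigma>1 - \<sigma>0) * T powr m"
        using \<open>B \<ge> 0\<close> \<sigma> by (intro mult_left_mono) auto
      thus "2 * B * (\<sigma>1 - \<sigma>0) \<le> 2 * B * (\<sigma>1 - \<sigma>0) * T powr m" by simp
      show "integral {T/2..3*T/2} (\<lambda>t. norm (G (Complex \<sigma>0 t))) \<le> exp D * C0 * T powr m"
        by (rule mean[OF _ mean0[OF T] c(1)]) (use \<sigma> in auto)
      show "integral {T/2..3*T/2} (\<lambda>t. norm (G (Complex \<sigma>1 t))) \<le> exp D * C1 * T powr m"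
        by (rule mean[OF _ mean1[OF T] c(2)]) (use \<sigma> in auto)
    qed (use \<sigma> in auto)
    also have "\<dots> = K * T powr m" by (simp add: K_def algebra_simps)
    finally show ?thesis by (simp add: field_simps)
  qed
  with poly \<open>0 \<le> m\<close> show ?thesis by (rule order_function_le_from_2)
qed

lemma continuous_on_vertical:
  assumes "f holomorphic_on {z. Im z > 0}" "a > 0"
  shows "continuous_on {a..b} (\<lambda>t. f (Complex \<sigma> t))"
proof (rule continuous_on_compose2[OF holomorphic_on_imp_continuous_on[OF assms(1)]])
  show "continuous_on {a..b} (Complex \<sigma>)"
    unfolding Complex_eq by (intro continuous_intros)
qed (use assms in auto)

lemma gaussian_mean_le_of_bound:
  assumes hol: "f holomorphic_on {z. Im z > 0}" and "0 \<le> m" "0 \<le> C"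
    and C: "\<And>t. t \<ge> 1 \<Longrightarrow> norm (f (Complex \<sigma> t)) \<le> C * t powr m" and T: "T \<ge> 2"
  shows "gaussian_mean f \<sigma> T \<le> C * 2 powr m * pi * T powr m"
proof -
  have "gaussian_mean f \<sigma> T \<le> integral {T/2..3*T/2} (\<lambda>t. C * 2 powr m * T powr m * exp (-(t - T)\<^sup>2))"
    unfolding gaussian_mean_def
  proof (rule integral_le)
    fix t assume t: "t \<in> {T/2..3*T/2}"
    have "norm (f (Complex \<sigma> t)) \<le> C * t powr m" using t T by (intro C) auto
    also have "\<dots> \<le> C * (2 * T) powr m"
      using t T assms by (intro mult_left_mono powr_mono2) auto
    finally show "norm (f (Complex \<sigma> t)) * exp (-(t - T)\<^sup>2) \<le> C * 2 powr m * T powr m * exp (-(t - T)\<^sup>2)"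
      using T by (intro mult_right_mono) (auto simp: powr_mult)
  qed (use T in \<open>auto intro!: integrable_continuous_real continuous_intros continuous_on_vertical[OF hol]\<close>)
  also have "\<dots> = C * 2 powr m * T powr m * integral {T/2..3*T/2} (\<lambda>t. exp (-(t - T)\<^sup>2))"
    by simp
  also have "\<dots> \<le> C * 2 powr m * T powr m * pi"
    using \<open>0 \<le> C\<close> by (intro mult_left_mono gaussian_integral_le_pi) auto
  finally show ?thesis by (simp add: mult_ac)
qed

lemma gaussian_mean_le_of_order:
  assumes hol: "f holomorphic_on {z. Im z > 0}" and poly: "polynomially_bounded_in_strips f"
    and m: "order_function f \<sigma> < m"
  obtains C where "\<And>T. T \<ge> 2 \<Longrightarrow> gaussian_mean f \<sigma> T \<le> C * T powr m"
proof -
  have "0 \<le> m" using order_function_nonneg[OF poly, of \<sigma>] m by simp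
  obtain C where "C \<ge> 0" "\<And>t. t \<ge> 1 \<Longrightarrow> norm (f (Complex \<sigma> t)) \<le> C * t powr m"
    using order_function_bound[OF poly m] by blast
  with gaussian_mean_le_of_bound[OF hol \<open>0 \<le> m\<close>] that show ?thesis by blast
qed

text \<open>The Phragmen-Lindelof theorem. Interpolation is applied to exponents exceeding the
  orders by \<open>e\<close>; the weights sum to 1, so the result exceeds the chord by exactly
  \<open>e\<close>.\<close>

lemma order_function_convex:
  assumes hol: "f holomorphic_on {z. Im z > 0}" and poly: "polynomially_bounded_in_strips f"
    and \<sigma>: "\<sigma>0 < \<sigma>" "\<sigma> < \<sigma>1"
  shows "order_function f \<sigma> \<le>
    ((\<sigma>1 - \<sigma>) * order_function f \<sigma>0 + (\<sigma> - \<sigma>0) * order_function f \<sigma>1) / (\<sigma>1 - \<sigma>0)"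
proof (rule field_le_epsilon)
  fix e :: real assume "e > 0"
  define m0 m1 where "m0 = order_function f \<sigma>0 + e" and "m1 = order_function f \<sigma>1 + e"
  have "order_function f \<sigma>0 < m0" "order_function f \<sigma>1 < m1"
    using \<open>e > 0\<close> by (auto simp: m0_def m1_def)
  then obtain C0 C1 where C: "\<And>T. T \<ge> 2 \<Longrightarrow> gaussian_mean f \<sigma>0 T \<le> C0 * T powr m0"
      "\<And>T. T \<ge> 2 \<Longrightarrow> gaussian_mean f \<sigma>1 T \<le> C1 * T powr m1"
    using gaussian_mean_le_of_order[OF hol poly] by metis
  have "order_function f \<sigma> \<le> ((\<sigma>1 - \<sigma>) * m0 + (\<sigma> - \<sigma>0) * m1) / (\<sigma>1 - \<sigma>0)"
  proof (rule order_function_le_interpolation[OF hol poly \<sigma> C refl])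
    show "((\<sigma>1 - \<sigma>) * m0 + (\<sigma> - \<sigma>0) * m1) / (\<sigma>1 - \<sigma>0) \<ge> 0"
      using \<sigma> \<open>e > 0\<close> order_function_nonneg[OF poly, of \<sigma>0] order_function_nonneg[OF poly, of \<sigma>1]
      by (intro divide_nonneg_nonneg add_nonneg_nonneg mult_nonneg_nonneg) (auto simp: m0_def m1_def)
  qed
  also have "\<dots> = ((\<sigma>1 - \<sigma>) * order_function f \<sigma>0 + (\<sigma> - \<sigma>0) * order_function f \<sigma>1) / (\<sigma>1 - \<sigma>0) + e"
    using \<sigma> by (simp add: m0_def m1_def field_simps)
  finally show "order_function f \<sigma> \<le>
    ((\<sigma>1 - \<sigma>) * order_function f \<sigma>0 + (\<sigma> - \<sigma>0) * order_function f \<sigma>1) / (\<sigma>1 - \<sigma>0) + e" .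
qed

section \<open>The order function and the finiteness of integrals of p-th powers\<close>

text \<open>A bridge from the nonnegative Lebesgue integral over a half-line, used in
  \<open>Lp_abscissa\<close>, to the gauge integral over a window, used in
  \<open>gaussian_mean\<close>.\<close>

lemma integral_le_of_nn_integral:
  fixes g :: "real \<Rightarrow> real"
  assumes cont: "continuous_on {a..b} g" and nonneg: "\<And>t. t \<in> {a..b} \<Longrightarrow> g t \<ge> 0"
    and sub: "{a..b} \<subseteq> A" and N: "(\<integral>\<^sup>+t\<in>A. ennreal (g t) \<partial>lborel) \<le> ennreal N" "N \<ge> 0"
  shows "integral {a..b} g \<le> N"
proof -
  have "(g has_integral integral {a..b} g) {a..b}"
    using integrable_continuous_real[OF cont] by (rule integrable_integral)
  from nn_integral_has_integral_lebesgue'[OF nonneg this]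
  have "ennreal (integral {a..b} g) = (\<integral>\<^sup>+t\<in>{a..b}. ennreal (g t) \<partial>lborel)" by simp
  also have "\<dots> \<le> (\<integral>\<^sup>+t\<in>A. ennreal (g t) \<partial>lborel)"
    using sub by (intro nn_integral_mono) (auto simp: indicator_def)
  also note N(1)
  finally show ?thesis using N(2) by (simp add: ennreal_le_iff)
qed

text \<open>Young's inequality in the form \<open>x \<le> 1 + x powr p\<close>, applied to
  \<open>x = \<bar>f\<bar> / T powr (\<alpha>/p)\<close>, makes the passage to the first power lossless.\<close>

lemma gaussian_mean_le_of_Lp:
  assumes hol: "f holomorphic_on {z. Im z > 0}" and p: "p \<ge> 1" and \<alpha>: "\<alpha> > 0"
    and fin: "(\<integral>\<^sup>+t\<in>{1..}. ennreal (norm (f (Complex \<sigma> t)) powr p / t powr \<alpha>) \<partial>lborel) < \<infinity>"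
  obtains C where "\<And>T. T \<ge> 2 \<Longrightarrow> gaussian_mean f \<sigma> T \<le> C * T powr (\<alpha> / p)"
proof -
  define g where "g = (\<lambda>t. norm (f (Complex \<sigma> t)) powr p / t powr \<alpha>)"
  define I where "I = (\<integral>\<^sup>+t\<in>{1..}. ennreal (g t) \<partial>lborel)"
  have "I < \<infinity>" using fin by (simp add: I_def g_def)
  then obtain N where "I = ennreal N" "N \<ge> 0" by (cases I) auto
  hence N: "(\<integral>\<^sup>+t\<in>{1..}. ennreal (g t) \<partial>lborel) = ennreal N" "N \<ge> 0"
    by (simp_all add: I_def)
  have g_nonneg: "g t \<ge> 0" for t by (simp add: g_def)
  have "gaussian_mean f \<sigma> T \<le> (pi + 2 powr \<alpha> * N) * T powr (\<alpha> / p)" if T: "T \<ge> 2" for T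
  proof -
    have cont: "continuous_on {T/2..3*T/2} g"
      unfolding g_def using T p
      by (auto intro!: continuous_intros continuous_on_vertical[OF hol] continuous_on_powr')
    have "gaussian_mean f \<sigma> T \<le>
        integral {T/2..3*T/2} (\<lambda>t. T powr (\<alpha>/p) * (exp (-(t - T)\<^sup>2) + 2 powr \<alpha> * g t))"
      unfolding gaussian_mean_def
    proof (rule integral_le)
      fix t assume t: "t \<in> {T/2..3*T/2}"
      define x where "x = norm (f (Complex \<sigma> t)) / T powr (\<alpha>/p)"
      have "x \<ge> 0" by (simp add: x_def)
      have "x \<le> 1 + x powr p"
      proof (cases "x \<le> 1")
        case True thus ?thesis by (simp add: add_increasing2)
      next
        case False
        hence "x powr 1 \<le> x powr p" using p by (intro powr_mono) auto
        thus ?thesis using False by simp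
      qed
      have "x powr p = norm (f (Complex \<sigma> t)) powr p / T powr \<alpha>"
        unfolding x_def using p by (simp add: powr_divide powr_powr)
      \<comment> \<open>On the window \<open>t / 2 \<le> T\<close>, so the height \<open>T\<close>
        may be exchanged for \<open>t\<close> at the cost of a factor
        \<open>2 powr \<alpha>\<close>.\<close>
      also have "\<dots> \<le> norm (f (Complex \<sigma> t)) powr p / (t / 2) powr \<alpha>"
        using t T \<alpha> by (intro divide_left_mono powr_mono2) auto
      also have "\<dots> = 2 powr \<alpha> * g t"
        using t T by (simp add: g_def powr_divide)
      finally have xp: "x powr p \<le> 2 powr \<alpha> * g t" .
      \<comment> \<open>The Gaussian is kept on the constant term, where the length of the window
        would cost a factor \<open>T\<close>. It is dropped on the p-th power, whose integral is
        already bounded by \<open>N\<close>.\<close>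
      have "x * exp (-(t - T)\<^sup>2) \<le> (1 + x powr p) * exp (-(t - T)\<^sup>2)"
        using \<open>x \<le> 1 + x powr p\<close> by (intro mult_right_mono) auto
      also have "\<dots> = exp (-(t - T)\<^sup>2) + x powr p * exp (-(t - T)\<^sup>2)"
        by (simp add: algebra_simps)
      also have "x powr p * exp (-(t - T)\<^sup>2) \<le> x powr p * 1"
        by (intro mult_left_mono) auto
      also note mult_1_right
      also note xp
      finally have "T powr (\<alpha>/p) * (x * exp (-(t - T)\<^sup>2)) \<le>
          T powr (\<alpha>/p) * (exp (-(t - T)\<^sup>2) + 2 powr \<alpha> * g t)"
        by (intro mult_left_mono) auto
      thus "norm (f (Complex \<sigma> t)) * exp (-(t - T)\<^sup>2) \<le>
          T powr (\<alpha>/p) * (exp (-(t - T)\<^sup>2) + 2 powr \<alpha> * g t)"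
        using T by (simp add: x_def)
    qed (use T in \<open>auto intro!: integrable_continuous_real continuous_intros cont continuous_on_vertical[OF hol]\<close>)
    also have "\<dots> = T powr (\<alpha>/p) * (integral {T/2..3*T/2} (\<lambda>t. exp (-(t - T)\<^sup>2))
        + 2 powr \<alpha> * integral {T/2..3*T/2} g)"
      by (subst integral_mult_right, subst integral_add)
         (auto intro!: integrable_continuous_real continuous_intros cont)
    also have "\<dots> \<le> T powr (\<alpha>/p) * (pi + 2 powr \<alpha> * N)"
      using T N g_nonneg
      by (intro mult_left_mono add_mono gaussian_integral_le_pi 
          integral_le_of_nn_integral[OF cont _ _ eq_refl[OF N(1)]]) auto
    finally show ?thesis by (simp add: mult_ac)
  qed
  thus ?thesis by (rule that)
qed

text \<open>The mean on the left line is bounded through the integral, the mean on the right line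
  through order zero. Both get the exponent \<open>\<alpha> / p\<close>, which interpolation
  preserves.\<close>

lemma order_function_le_of_Lp:
  assumes hol: "f holomorphic_on {z. Im z > 0}" and poly: "polynomially_bounded_in_strips f"
    and p: "p \<ge> 1" and \<alpha>: "\<alpha> > 0"
    and fin: "(\<integral>\<^sup>+t\<in>{1..}. ennreal (norm (f (Complex \<sigma>0 t)) powr p / t powr \<alpha>) \<partial>lborel) < \<infinity>"
    and \<sigma>: "\<sigma>0 < \<sigma>" "\<sigma> < \<sigma>1" and \<sigma>1: "order_function f \<sigma>1 = 0"
  shows "order_function f \<sigma> \<le> \<alpha> / p"
proof -
  have pos: "0 < \<alpha> / p" using p \<alpha> by simp
  obtain C0 where C0: "\<And>T. T \<ge> 2 \<Longrightarrow> gaussian_mean f \<sigma>0 T \<le> C0 * T powr (\<alpha> / p)"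
    using gaussian_mean_le_of_Lp[OF hol p \<alpha> fin] by blast
  obtain C1 where C1: "\<And>T. T \<ge> 2 \<Longrightarrow> gaussian_mean f \<sigma>1 T \<le> C1 * T powr (\<alpha> / p)"
    using gaussian_mean_le_of_order[OF hol poly, of \<sigma>1 "\<alpha>/p"] pos \<sigma>1 by auto
  show ?thesis
    by (rule order_function_le_interpolation[OF hol poly \<sigma> C0 C1])
       (use \<sigma> pos p in \<open>auto simp: field_simps\<close>)
qed

text \<open>The strict inequality leaves room for an exponent \<open>m\<close> with
  \<open>m * p - \<alpha> < -1\<close>, so the integrand is dominated by an integrable
  power.\<close>

lemma Lp_finite_of_order:
  assumes hol: "f holomorphic_on {z. Im z > 0}" and poly: "polynomially_bounded_in_strips f"
    and p: "p > 0" and \<sigma>: "order_function f \<sigma> < (\<alpha> - 1) / p"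
  shows "(\<integral>\<^sup>+t\<in>{1..}. ennreal (norm (f (Complex \<sigma> t)) powr p / t powr \<alpha>) \<partial>lborel) < \<infinity>"
proof -
  obtain m where m: "order_function f \<sigma> < m" "m < (\<alpha> - 1) / p"
    using \<sigma> dense by blast
  obtain C where "C \<ge> 0" and C: "\<And>t. t \<ge> 1 \<Longrightarrow> norm (f (Complex \<sigma> t)) \<le> C * t powr m"
    using order_function_bound[OF poly m(1)] by blast
  define e where "e = m * p - \<alpha>"
  have "e < -1" using m(2) p by (simp add: e_def field_simps)
  have "((\<lambda>t. t powr e) has_integral -(1 powr (e+1)) / (e+1)) {1..}"
    using \<open>e < -1\<close> by (intro has_integral_powr_to_inf) auto
  hence "((\<lambda>t. C powr p * t powr e) has_integral C powr p * (-(1 powr (e+1)) / (e+1))) {1..}"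
    by (rule has_integral_mult_right)
  hence "(\<integral>\<^sup>+t\<in>{1..}. ennreal (C powr p * t powr e) \<partial>lborel) = ennreal (C powr p * (-(1 powr (e+1)) / (e+1)))"
    by (intro nn_integral_has_integral_lebesgue') auto
  hence fin: "(\<integral>\<^sup>+t\<in>{1..}. ennreal (C powr p * t powr e) \<partial>lborel) < \<infinity>" by simp
  have "(\<integral>\<^sup>+t\<in>{1..}. ennreal (norm (f (Complex \<sigma> t)) powr p / t powr \<alpha>) \<partial>lborel) \<le>
        (\<integral>\<^sup>+t\<in>{1..}. ennreal (C powr p * t powr e) \<partial>lborel)"
  proof (rule nn_integral_mono)
    fix t :: real
    show "ennreal (norm (f (Complex \<sigma> t)) powr p / t powr \<alpha>) * indicator {1..} t \<le>
          ennreal (C powr p * t powr e) * indicator {1..} t"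
    proof (cases "t \<ge> 1")
      case True
      have "norm (f (Complex \<sigma> t)) powr p \<le> (C * t powr m) powr p"
        using p by (intro powr_mono2 C True) auto
      also have "\<dots> = C powr p * t powr (m * p)"
        using \<open>C \<ge> 0\<close> by (simp add: powr_mult powr_powr)
      finally have "norm (f (Complex \<sigma> t)) powr p / t powr \<alpha> \<le> C powr p * t powr (m * p) / t powr \<alpha>"
        by (intro divide_right_mono) auto
      also have "\<dots> = C powr p * t powr e" by (simp add: e_def powr_diff)
      finally show ?thesis by (intro mult_right_mono ennreal_leI) auto
    qed auto
  qed
  from this fin show ?thesis by (rule le_less_trans)
qed

lemma Lp_abscissa_le:
  assumes hol: "f holomorphic_on {z. Im z > 0}" and poly: "polynomially_bounded_in_strips f"
    and "p > 0" "\<sigma> \<in> {a..1}" "order_function f \<sigma> < (\<alpha> - 1) / p"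
  shows "Lp_abscissa f a p \<alpha> \<le> \<sigma>"
  unfolding Lp_abscissa_def using Lp_finite_of_order[OF hol poly] assms
  by (intro cInf_lower) (auto intro: bdd_belowI[of _ a])

text \<open>A line of finiteness to the left of \<open>x\<close> would force the order at some point
  strictly between to be at most \<open>\<alpha> / p\<close>.\<close>

lemma Lp_abscissa_ge:
  assumes hol: "f holomorphic_on {z. Im z > 0}" and poly: "polynomially_bounded_in_strips f"
    and p: "p \<ge> 1" and \<alpha>: "\<alpha> > 1" and "a \<le> 1" and one: "order_function f 1 = 0"
    and "x \<le> 1" and x: "\<And>\<sigma>. a < \<sigma> \<Longrightarrow> \<sigma> < x \<Longrightarrow> \<alpha> / p < order_function f \<sigma>"
  shows "x \<le> Lp_abscissa f a p \<alpha>"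
  unfolding Lp_abscissa_def
proof (rule cInf_greatest)
  \<comment> \<open>The point 1 belongs to the set, which makes the infimum genuine.\<close>
  have "order_function f 1 < (\<alpha> - 1) / p" using one p \<alpha> by simp
  hence "(\<integral>\<^sup>+t\<in>{1..}. ennreal (norm (f (Complex 1 t)) powr p / t powr \<alpha>) \<partial>lborel) < \<infinity>"
    using p by (intro Lp_finite_of_order[OF hol poly]) auto
  thus "{\<sigma> \<in> {a..1}. (\<integral>\<^sup>+t\<in>{1..}. ennreal (norm (f (Complex \<sigma> t)) powr p / t powr \<alpha>) \<partial>lborel) < \<infinity>} \<noteq> {}"
    using \<open>a \<le> 1\<close> by auto
next
  fix \<sigma>0
  assume \<sigma>0: "\<sigma>0 \<in> {\<sigma> \<in> {a..1}. (\<integral>\<^sup>+t\<in>{1..}. ennreal (norm (f (Complex \<sigma> t)) powr p / t powr \<alpha>) \<partial>lborel) < \<infinity>}"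
  show "x \<le> \<sigma>0"
  proof (rule ccontr)
    assume "\<not> x \<le> \<sigma>0"
    then obtain \<sigma> where \<sigma>: "\<sigma>0 < \<sigma>" "\<sigma> < x" using dense not_le by metis
    have "order_function f \<sigma> \<le> \<alpha> / p"
      using \<sigma>0 \<sigma> \<alpha> \<open>x \<le> 1\<close> by (intro order_function_le_of_Lp[OF hol poly p _ _ _ _ one]) auto
    moreover have "\<alpha> / p < order_function f \<sigma>" using x[of \<sigma>] \<sigma> \<sigma>0 by auto
    ultimately show False by simp
  qed
qed

text \<open>By convexity the value at \<open>\<sigma>'\<close> lies below the chord from
  \<open>\<sigma>\<close> to the zero at 1, hence is at most a fraction less than 1 of the value at
  \<open>\<sigma>\<close>.\<close>

lemma order_function_strict_decreasing:
  assumes hol: "f holomorphic_on {z. Im z > 0}" and poly: "polynomially_bounded_in_strips f"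
    and zero: "\<And>\<sigma>. \<sigma> \<ge> 1 \<Longrightarrow> order_function f \<sigma> = 0"
    and \<sigma>: "\<sigma> < \<sigma>'" and pos: "order_function f \<sigma>' > 0"
  shows "order_function f \<sigma>' < order_function f \<sigma>"
proof -
  have "\<sigma>' < 1" using zero[of \<sigma>'] pos by force
  have le: "order_function f \<sigma>' \<le> (1 - \<sigma>') / (1 - \<sigma>) * order_function f \<sigma>"
    using order_function_convex[OF hol poly \<sigma> \<open>\<sigma>' < 1\<close>] zero[of 1] by simp
  hence "order_function f \<sigma> > 0"
    using pos order_function_nonneg[OF poly, of \<sigma>] by (cases "order_function f \<sigma> = 0") auto
  hence "(1 - \<sigma>') / (1 - \<sigma>) * order_function f \<sigma> < 1 * order_function f \<sigma>"
    using \<sigma> \<open>\<sigma>' < 1\<close> by (intro mult_strict_right_mono) auto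
  with le show ?thesis by simp
qed

section \<open>From the Lindelof hypothesis to approximate concavity\<close>

text \<open>Convexity of \<open>1 / x\<close>: average the tangent line at the weighted mean of
  \<open>q\<close> and \<open>r\<close>.\<close>

lemma weighted_harmonic_mean_le:
  fixes q r \<phi> :: real
  assumes "q > 0" "r > 0" "\<phi> \<in> {0..1}"
  shows "1 / (\<phi> * q + (1 - \<phi>) * r) \<le> \<phi> / q + (1 - \<phi>) / r"
proof -
  define p where "p = \<phi> * q + (1 - \<phi>) * r"
  have "p > 0"
  proof (cases "\<phi> = 0")
    case False
    thus ?thesis unfolding p_def using assms by (intro add_pos_nonneg mult_pos_pos mult_nonneg_nonneg) auto
  qed (use assms in \<open>auto simp: p_def\<close>)
  have tangent: "2 / p - x / p\<^sup>2 \<le> 1 / x" if "x > 0" for x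
  proof -
    have "0 \<le> (p - x)\<^sup>2 / (x * p\<^sup>2)" using that by simp
    also have "\<dots> = 1 / x - (2 / p - x / p\<^sup>2)"
      using that \<open>p > 0\<close> by (simp add: field_simps power2_eq_square)
    finally show ?thesis by simp
  qed
  have "1 / p = 2 / p - p / p\<^sup>2"
    using \<open>p > 0\<close> by (simp add: field_simps power2_eq_square)
  also have "\<dots> = \<phi> * (2 / p - q / p\<^sup>2) + (1 - \<phi>) * (2 / p - r / p\<^sup>2)"
    unfolding p_def by (simp add: diff_divide_distrib add_divide_distrib algebra_simps)
  also have "\<dots> \<le> \<phi> * (1 / q) + (1 - \<phi>) * (1 / r)"
    using assms by (intro add_mono mult_left_mono tangent) auto
  finally show ?thesis by (simp add: p_def)
qed

text \<open>The abscissa lies between \<open>1/2 - \<alpha> / (d * p)\<close> and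
  \<open>1/2 - (\<alpha> - 1) / (d * p)\<close>. The upper bound is concave in \<open>p\<close>, and
  the two differ by \<open>1 / (d * p)\<close>, which is small for large \<open>p\<close>.\<close>

lemma approx_concave_of_linear_order:
  assumes hol: "f holomorphic_on {z. Im z > 0}" and poly: "polynomially_bounded_in_strips f"
    and d: "d > 0" and left: "\<And>\<sigma>. \<sigma> \<le> 1/2 \<Longrightarrow> order_function f \<sigma> = d * (1/2 - \<sigma>)"
    and right: "\<And>\<sigma>. \<sigma> \<ge> 1/2 \<Longrightarrow> order_function f \<sigma> = 0"
  shows "approx_concave f"
  unfolding approx_concave_def approx_concave_on_strip_def
proof safe
  fix a \<epsilon> :: real assume "a < 1" and a: "order_function f a > 0" and "\<epsilon> > 0"
  have "a < 1/2" using a right[of a] by force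
  hence \<mu>a: "order_function f a = d * (1/2 - a)" by (intro left) auto
  \<comment> \<open>This holds for every \<open>q > 0\<close>: when only the mean of
    \<open>q\<close> and \<open>r\<close> is known to be large, one of them may be small.\<close>
  have upper: "Lp_abscissa f a q \<alpha> \<le> 1/2 - (\<alpha> - 1) / (d * q)"
    if "q > 0" "1 < \<alpha>" "\<alpha> \<le> order_function f a * q" for q \<alpha>
  proof (rule field_le_epsilon)
    fix e :: real assume "e > 0"
    define s where "s = 1/2 - (\<alpha> - 1) / (d * q)"
    \<comment> \<open>A point strictly right of \<open>s\<close> yields the strict inequality of
      \<open>Lp_abscissa_le\<close>; the cap at \<open>1/2\<close> stays where the order is
      linear.\<close>
    define \<sigma> where "\<sigma> = min (s + e) (1/2)"
    have "(\<alpha> - 1) / (d * q) > 0" using that d by simp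
    hence "s < 1/2" unfolding s_def by linarith
    have "(\<alpha> - 1) / (d * q) \<le> 1/2 - a" using that d by (simp add: \<mu>a field_simps)
    hence "a \<le> s" by (simp add: s_def)
    have "s < \<sigma>" "\<sigma> \<le> 1/2" using \<open>s < 1/2\<close> \<open>e > 0\<close> unfolding \<sigma>_def by linarith+
    have "Lp_abscissa f a q \<alpha> \<le> \<sigma>"
    proof (rule Lp_abscissa_le[OF hol poly \<open>q > 0\<close>])
      have "order_function f \<sigma> = d * (1/2 - \<sigma>)" using \<open>\<sigma> \<le> 1/2\<close> by (rule left)
      also have "\<dots> < d * (1/2 - s)" using d \<open>s < \<sigma>\<close> by (intro mult_strict_left_mono) auto
      also have "\<dots> = (\<alpha> - 1) / q" using d by (simp add: s_def)
      finally show "order_function f \<sigma> < (\<alpha> - 1) / q" .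
    qed (use \<open>a \<le> s\<close> \<open>s < \<sigma>\<close> \<open>\<sigma> \<le> 1/2\<close> in auto)
    thus "Lp_abscissa f a q \<alpha> \<le> 1/2 - (\<alpha> - 1) / (d * q) + e"
      by (simp add: \<sigma>_def s_def)
  qed
  have lower: "1/2 - \<alpha> / (d * p) \<le> Lp_abscissa f a p \<alpha>" if "p \<ge> 1" "1 < \<alpha>" for p \<alpha>
  proof (rule Lp_abscissa_ge[OF hol poly that])
    have "\<alpha> / (d * p) > 0" using that d by simp
    thus "1/2 - \<alpha> / (d * p) \<le> 1" by simp
    fix \<sigma> assume \<sigma>: "\<sigma> < 1/2 - \<alpha> / (d * p)"
    have "\<alpha> / p = d * (\<alpha> / (d * p))" using d by simp
    also have "\<dots> < d * (1/2 - \<sigma>)" using \<sigma> d by (intro mult_strict_left_mono) auto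
    also have "\<dots> = order_function f \<sigma>"
      using \<sigma> \<open>\<alpha> / (d * p) > 0\<close> by (intro left[symmetric]) auto
    finally show "\<alpha> / p < order_function f \<sigma>" .
  qed (use \<open>a < 1\<close> right[of 1] in auto)
  show "\<exists>P. \<forall>q>0. \<forall>r>0. \<forall>\<phi>\<in>{0..1}. \<forall>\<alpha>.
        \<phi> * q + (1 - \<phi>) * r \<ge> P \<longrightarrow> 1 < \<alpha> \<longrightarrow> \<alpha> \<le> order_function f a * min q r \<longrightarrow>
        \<phi> * Lp_abscissa f a q \<alpha> + (1 - \<phi>) * Lp_abscissa f a r \<alpha>
          \<le> Lp_abscissa f a (\<phi> * q + (1 - \<phi>) * r) \<alpha> + \<epsilon>"
  \<comment> \<open>The first entry admits the lower bound at \<open>p\<close>, the second makes the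
    gap \<open>1 / (d * p)\<close> at most \<open>\<epsilon>\<close>.\<close>
  proof (intro exI[of _ "max 1 (1 / (d * \<epsilon>))"] allI ballI impI)
    fix q r \<phi> \<alpha> :: real
    assume q: "q > 0" and r: "r > 0" and \<phi>: "\<phi> \<in> {0..1}" and \<alpha>: "1 < \<alpha>"
      and P: "max 1 (1 / (d * \<epsilon>)) \<le> \<phi> * q + (1 - \<phi>) * r"
      and min: "\<alpha> \<le> order_function f a * min q r"
    define p where "p = \<phi> * q + (1 - \<phi>) * r"
    have p: "p \<ge> 1" "1 / (d * \<epsilon>) \<le> p" using P by (auto simp: p_def)
    have "order_function f a * min q r \<le> order_function f a * q"
         "order_function f a * min q r \<le> order_function f a * r"
      using a by (auto intro!: mult_left_mono)
    with min have "\<alpha> \<le> order_function f a * q" "\<alpha> \<le> order_function f a * r" by linarith+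
    hence "\<phi> * Lp_abscissa f a q \<alpha> + (1 - \<phi>) * Lp_abscissa f a r \<alpha> \<le>
          \<phi> * (1/2 - (\<alpha> - 1) / (d * q)) + (1 - \<phi>) * (1/2 - (\<alpha> - 1) / (d * r))"
      using \<phi> q r \<alpha> by (intro add_mono mult_left_mono upper) auto
    also have "\<dots> = 1/2 - (\<alpha> - 1) / d * (\<phi> / q + (1 - \<phi>) / r)"
      using d q r by (simp add: field_simps)
    also have "\<dots> \<le> 1/2 - (\<alpha> - 1) / d * (1 / p)"
      using \<alpha> d weighted_harmonic_mean_le[OF q r \<phi>] unfolding p_def
      by (intro diff_left_mono mult_left_mono) auto
    also have "\<dots> = 1/2 - \<alpha> / (d * p) + 1 / (d * p)"
      using d p by (simp add: field_simps)
    also have "1 / (d * p) \<le> \<epsilon>"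
      using p d \<open>\<epsilon> > 0\<close> by (simp add: field_simps)
    also have "1/2 - \<alpha> / (d * p) \<le> Lp_abscissa f a p \<alpha>"
      by (rule lower[OF p(1) \<alpha>])
    finally show "\<phi> * Lp_abscissa f a q \<alpha> + (1 - \<phi>) * Lp_abscissa f a r \<alpha> \<le>
        Lp_abscissa f a (\<phi> * q + (1 - \<phi>) * r) \<alpha> + \<epsilon>" by (simp add: p_def)
  qed
qed

section \<open>From approximate concavity to convexity of the reciprocal order\<close>

text \<open>Take \<open>\<alpha> = T\<close> and the exponents \<open>T * x\<close>,
  \<open>T * y\<close> with midpoint \<open>T * z\<close>. The outer abscissae are at least
  \<open>\<sigma>1\<close> and \<open>\<sigma>3\<close>. If the claim fails, the middle one is at
  most \<open>\<sigma> - \<delta>\<close> for large \<open>T\<close>, which contradicts concavity up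
  to \<open>\<delta> / 2\<close>.\<close>

lemma approx_concave_imp_reciprocal_midpoint:
  assumes hol: "f holomorphic_on {z. Im z > 0}" and poly: "polynomially_bounded_in_strips f"
    and zero: "\<And>\<sigma>. \<sigma> \<ge> 1 \<Longrightarrow> order_function f \<sigma> = 0"
    and conc: "approx_concave f" and \<sigma>13: "\<sigma>1 < \<sigma>3" and pos: "order_function f \<sigma>3 > 0"
    and \<sigma>_def: "\<sigma> = (\<sigma>1 + \<sigma>3) / 2"
  shows "2 / order_function f \<sigma> \<le> 1 / order_function f \<sigma>1 + 1 / order_function f \<sigma>3"
proof (rule ccontr)
  assume neg: "\<not> 2 / order_function f \<sigma> \<le> 1 / order_function f \<sigma>1 + 1 / order_function f \<sigma>3"
  define \<mu> where "\<mu> = order_function f"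
  have decreasing: "\<mu> \<sigma>' < \<mu> \<sigma>" if "\<sigma> < \<sigma>'" "\<mu> \<sigma>' > 0" for \<sigma> \<sigma>'
    unfolding \<mu>_def using that[unfolded \<mu>_def] zero
    by (intro order_function_strict_decreasing[OF hol poly]) auto
  note pos = pos[folded \<mu>_def]
  have \<sigma>: "\<sigma>1 < \<sigma>" "\<sigma> < \<sigma>3" using \<sigma>13 by (auto simp: \<sigma>_def)
  have "\<sigma>3 < 1" using zero[of \<sigma>3] pos by (force simp: \<mu>_def)
  have \<mu>: "\<mu> \<sigma>3 < \<mu> \<sigma>" using decreasing[OF \<sigma>(2) pos] .
  have \<mu>': "\<mu> \<sigma> < \<mu> \<sigma>1" using decreasing[OF \<sigma>(1)] \<mu> pos by simp
  define x y z where "x = 1 / \<mu> \<sigma>1" and "y = 1 / \<mu> \<sigma>3" and "z = (x + y) / 2"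
  have xy: "0 < x" "x < y" "0 < z"
    using \<mu> \<mu>' pos by (auto simp: x_def y_def z_def field_simps intro!: add_pos_pos)
  have "z < 1 / \<mu> \<sigma>" using neg by (simp add: z_def x_def y_def \<mu>_def)
  hence z: "\<mu> \<sigma> < 1 / z" using xy \<mu> pos by (simp add: field_simps)
  \<comment> \<open>\<open>t\<close> is chosen to satisfy both \<open>t < 1\<close> and
    \<open>t * (\<mu> \<sigma>1 - \<mu> \<sigma>) < g\<close>. Moving left by the fraction
    \<open>t\<close> of the way to \<open>\<sigma>1\<close> then keeps the order below
    \<open>1 / z\<close>, by convexity.\<close>
  define g t where "g = 1 / z - \<mu> \<sigma>" and "t = g / (g + (\<mu> \<sigma>1 - \<mu> \<sigma>))"
  have "g > 0" using z by (simp add: g_def)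
  hence t: "0 < t" "t < 1" "t * (\<mu> \<sigma>1 - \<mu> \<sigma>) < g"
    using \<mu>' by (simp_all add: t_def field_simps)
  define \<delta> where "\<delta> = t * (\<sigma> - \<sigma>1)"
  have "\<delta> < 1 * (\<sigma> - \<sigma>1)"
    unfolding \<delta>_def using t \<sigma> by (intro mult_strict_right_mono) auto
  moreover have "0 < \<delta>" using t \<sigma> by (simp add: \<delta>_def)
  ultimately have \<delta>: "0 < \<delta>" "\<sigma>1 < \<sigma> - \<delta>" by simp_all
  have "\<mu> (\<sigma> - \<delta>) \<le> (\<delta> * \<mu> \<sigma>1 + (\<sigma> - \<delta> - \<sigma>1) * \<mu> \<sigma>) / (\<sigma> - \<sigma>1)"
    using order_function_convex[OF hol poly \<delta>(2), of \<sigma>] \<delta> by (simp add: \<mu>_def)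
  also have "\<dots> = \<mu> \<sigma> + t * (\<mu> \<sigma>1 - \<mu> \<sigma>)"
    using \<sigma> by (simp add: \<delta>_def field_simps)
  also have "\<dots> < 1 / z" using t by (simp add: g_def)
  finally have gap: "\<mu> (\<sigma> - \<delta>) < 1 / z" .
  \<comment> \<open>With left edge \<open>\<sigma>1\<close> the admissibility condition on \<alpha>
    holds with equality, as \<open>\<mu> \<sigma>1 * (T * x) = T\<close>.\<close>
  have strip: "approx_concave_on_strip f \<sigma>1"
    using conc \<mu> \<mu>' pos \<sigma> \<open>\<sigma>3 < 1\<close> by (simp add: approx_concave_def \<mu>_def)
  obtain P where P: "\<forall>q>0. \<forall>r>0. \<forall>\<phi>\<in>{0..1}. \<forall>\<alpha>. \<phi> * q + (1 - \<phi>) * r \<ge> P \<longrightarrow>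
      1 < \<alpha> \<longrightarrow> \<alpha> \<le> order_function f \<sigma>1 * min q r \<longrightarrow>
      \<phi> * Lp_abscissa f \<sigma>1 q \<alpha> + (1 - \<phi>) * Lp_abscissa f \<sigma>1 r \<alpha>
        \<le> Lp_abscissa f \<sigma>1 (\<phi> * q + (1 - \<phi>) * r) \<alpha> + \<delta> / 2"
    using strip[unfolded approx_concave_on_strip_def, rule_format, OF half_gt_zero[OF \<delta>(1)]]
    by (elim exE)
  \<comment> \<open>The discrepancy between \<open>\<alpha> - 1\<close> and \<alpha> in the two
    abscissa bounds disappears as \<open>T\<close> grows, since \<open>(T - 1) / (T * z)\<close>
    tends to \<open>1 / z\<close>.\<close>
  have "eventually (\<lambda>T. T > 1 \<and> T * x \<ge> 1 \<and> T * y \<ge> 1 \<and> T * z \<ge> P \<and> \<mu> (\<sigma> - \<delta>) < (T - 1) / (T * z)) at_top"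
  proof (intro eventually_conj)
    have large: "eventually (\<lambda>T. T * w \<ge> M) at_top" if "w > 0" for w M :: real
      using eventually_ge_at_top[of "M / w"] by eventually_elim (use that in \<open>simp add: field_simps\<close>)
    show "eventually (\<lambda>T. T * x \<ge> 1) at_top" "eventually (\<lambda>T. T * y \<ge> 1) at_top"
      "eventually (\<lambda>T. T * z \<ge> P) at_top" using xy by (auto intro!: large)
    have "((\<lambda>T. (T - 1) / (T * z)) \<longlongrightarrow> inverse z) at_top"
      using xy(3) by real_asymp
    from this[unfolded inverse_eq_divide] show "eventually (\<lambda>T. \<mu> (\<sigma> - \<delta>) < (T - 1) / (T * z)) at_top"
      using gap by (rule order_tendstoD)
  qed (rule eventually_gt_at_top)
  then obtain T where T: "T > 1" "T * x \<ge> 1" "T * y \<ge> 1" "T * z \<ge> P" "\<mu> (\<sigma> - \<delta>) < (T - 1) / (T * z)"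
    using eventually_happens[of _ at_top] by fastforce
  have Tz: "T * z = 1/2 * (T * x) + (1 - 1/2) * (T * y)"
    by (simp add: z_def field_simps)
  \<comment> \<open>The condition on the order is vacuous at the left edge of the strip.\<close>
  have "\<sigma>1 \<le> Lp_abscissa f \<sigma>1 (T * x) T"
    using \<sigma> \<open>\<sigma>3 < 1\<close> zero by (intro Lp_abscissa_ge[OF hol poly T(2,1)]) auto
  moreover have "\<sigma>3 \<le> Lp_abscissa f \<sigma>1 (T * y) T"
  proof (intro Lp_abscissa_ge[OF hol poly T(3,1)])
    fix \<sigma>' assume "\<sigma>' < \<sigma>3"
    from decreasing[OF this pos] show "T / (T * y) < order_function f \<sigma>'"
      using T pos by (simp add: y_def \<mu>_def)
  qed (use \<sigma> \<open>\<sigma>3 < 1\<close> zero in auto)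
  moreover have "Lp_abscissa f \<sigma>1 (T * z) T \<le> \<sigma> - \<delta>"
    using T xy \<sigma> \<delta> \<open>\<sigma>3 < 1\<close> by (intro Lp_abscissa_le[OF hol poly]) (auto simp: \<mu>_def)
  moreover have "1/2 * Lp_abscissa f \<sigma>1 (T * x) T + (1 - 1/2) * Lp_abscissa f \<sigma>1 (T * y) T
        \<le> Lp_abscissa f \<sigma>1 (T * z) T + \<delta> / 2"
    unfolding Tz
  proof (rule P[rule_format])
    show "P \<le> 1/2 * (T * x) + (1 - 1/2) * (T * y)"
      using T(4) unfolding Tz .
    have "min (T * x) (T * y) = T * x" using xy T by (intro min_absorb1 mult_left_mono) auto
    thus "T \<le> order_function f \<sigma>1 * min (T * x) (T * y)"
      using \<mu> \<mu>' pos by (simp add: x_def \<mu>_def)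
  qed (use T xy in auto)
  ultimately show False using \<delta>(1) unfolding \<sigma>_def by argo
qed

section \<open>Differentiability at 1/2 and the equivalence\<close>

text \<open>Convexity of the order bounds the right difference quotient at 1/2 from below by
  \<open>-(d/2)\<close>, and convexity of the reciprocal bounds it from above by a quantity tending
  to \<open>-(d/2)\<close>. The functional equation reflects this to the left.\<close>

lemma order_function_differentiable_of_approx_concave:
  assumes hol: "f holomorphic_on {z. Im z > 0}" and poly: "polynomially_bounded_in_strips f"
    and d: "d > 0"
    and fe: "\<And>\<sigma>. order_function f \<sigma> = order_function f (1 - \<sigma>) + d * (1/2 - \<sigma>)"
    and zero: "\<And>\<sigma>. \<sigma> \<ge> 1 \<Longrightarrow> order_function f \<sigma> = 0"
    and conc: "approx_concave f" and pos: "order_function f (1/2) > 0"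
  shows "(order_function f has_real_derivative -(d/2)) (at (1/2))"
proof -
  define \<mu> where "\<mu> = order_function f"
  define m where "m = \<mu> (1/2)"
  have "m > 0" using pos by (simp add: m_def \<mu>_def)
  \<comment> \<open>The error in the upper bound for the quotient; it is continuous at 0 with value
    0.\<close>
  define F where "F = (\<lambda>h. d * (m / (2 * m - d * h) - 1) + d / 2)"
  have squeeze: "\<bar>(\<mu> (1/2 + h) - m) / h + d/2\<bar> \<le> F h" if h: "0 < h" "h < m / d" for h
  proof -
    define u v where "u = \<mu> (1/2 + h)" and "v = \<mu> (1/2 - h)"
    have v: "v = u + d * h"
      using fe[of "1/2 - h"] by (simp add: u_def v_def \<mu>_def add_ac)
    have "m \<le> (h * v + h * u) / (2 * h)"
      using order_function_convex[OF hol poly, of "1/2 - h" "1/2" "1/2 + h"] h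
      by (simp add: m_def u_def v_def \<mu>_def)
    also have "\<dots> = u + d * h / 2" using h by (simp add: v field_simps)
    finally have low: "u \<ge> m - d * h / 2" by simp
    \<comment> \<open>This range of \<open>h\<close> keeps \<open>u\<close> and the denominator
      \<open>2 * m - d * h\<close> positive.\<close>
    have "d * h < m" using h d by (simp add: field_simps)
    have "u > 0" using low \<open>d * h < m\<close> \<open>m > 0\<close> by linarith
    have "v > 0" using \<open>u > 0\<close> d h by (simp add: v add_pos_pos)
    have "2 / m \<le> 1 / v + 1 / u"
      using approx_concave_imp_reciprocal_midpoint[OF hol poly zero conc, of "1/2 - h" "1/2 + h" "1/2"]
        h \<open>u > 0\<close> by (simp add: m_def u_def v_def \<mu>_def)
    \<comment> \<open>Clearing denominators and inserting \<open>v = u + d * h\<close> bounds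
      \<open>u - m + d * h\<close> by a quotient over \<open>2 * u\<close>; the lower bound
      \<open>low\<close> then eliminates \<open>u\<close>.\<close>
    hence "2 / m * (m * u * v) \<le> (1 / v + 1 / u) * (m * u * v)"
      using \<open>u > 0\<close> \<open>v > 0\<close> \<open>m > 0\<close> by (intro mult_right_mono) auto
    moreover have "2 / m * (m * u * v) = 2 * (u * v)" "(1 / v + 1 / u) * (m * u * v) = m * (u + v)"
      using \<open>u > 0\<close> \<open>v > 0\<close> \<open>m > 0\<close> by (simp_all add: field_simps)
    ultimately have "2 * (u * v) \<le> m * (u + v)" by simp
    hence "2 * u * (u - m + d * h) \<le> d * h * m"
      by (simp add: v algebra_simps)
    hence "u - m + d * h \<le> d * h * m / (2 * u)"
      using \<open>u > 0\<close> by (simp add: field_simps)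
    also have "\<dots> \<le> d * h * m / (2 * m - d * h)"
      using low \<open>d * h < m\<close> \<open>m > 0\<close> \<open>u > 0\<close> d h by (intro divide_left_mono) auto
    finally have "(u - m) / h \<le> (d * h * m / (2 * m - d * h) - d * h) / h"
      using h by (intro divide_right_mono) auto
    also have "\<dots> = d * (m / (2 * m - d * h) - 1)"
      using h by (simp add: diff_divide_distrib right_diff_distrib)
    finally have "(u - m) / h + d/2 \<le> F h" by (simp add: F_def)
    moreover have "(u - m) / h + d/2 \<ge> 0"
      using low h by (simp add: field_simps)
    ultimately show ?thesis by (simp add: u_def)
  qed
  have "((\<lambda>h. (\<mu> (1/2 + h) - m) / h + d/2) \<longlongrightarrow> 0) (at 0)"
  proof (rule Lim_null_comparison)
    have "eventually (\<lambda>h. h \<noteq> 0 \<and> \<bar>h\<bar> < m / d) (at (0::real))"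
      using \<open>m > 0\<close> d by (auto simp: eventually_at intro!: exI[of _ "m / d"])
    thus "eventually (\<lambda>h. norm ((\<mu> (1/2 + h) - m) / h + d/2) \<le> F \<bar>h\<bar>) (at 0)"
    proof eventually_elim
      case (elim h)
      show ?case
      proof (cases "h > 0")
        case True
        thus ?thesis using squeeze[of h] elim by simp
      next
        case False
        then obtain k where h: "h = -k" and k: "0 < k" "k < m / d"
          using elim by (intro that[of "-h"]) auto
        \<comment> \<open>Under reflection the quotient plus \<open>d/2\<close> merely changes
          sign.\<close>
        have eq: "\<mu> (1/2 + h) = \<mu> (1/2 + k) + d * k"
          using fe[of "1/2 - k"] by (simp add: h \<mu>_def add_ac)
        have "(\<mu> (1/2 + h) - m) / h + d/2 = -((\<mu> (1/2 + k) - m) / k + d/2)"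
          unfolding eq unfolding h using k by (simp add: diff_divide_distrib add_divide_distrib)
        thus ?thesis using squeeze[OF k] k by (simp add: h)
      qed
    qed
    have "isCont (\<lambda>h. F \<bar>h\<bar>) 0"
      unfolding F_def using \<open>m > 0\<close> by (intro continuous_intros) auto
    thus "((\<lambda>h. F \<bar>h\<bar>) \<longlongrightarrow> 0) (at 0)"
      using \<open>m > 0\<close> by (simp add: isCont_def F_def)
  qed
  from tendsto_add[OF this tendsto_const[of "-(d/2)"]]
  have "((\<lambda>h. (\<mu> (1/2 + h) - m) / h) \<longlongrightarrow> -(d/2)) (at 0)" by simp
  thus ?thesis by (simp add: DERIV_def \<mu>_def m_def)
qed

theorem mainTheorem2:
  fixes f :: "complex \<Rightarrow> complex" and d :: real
  assumes "f analytic_on {z. Im z > 0}"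
    and "polynomially_bounded_in_strips f"
    and "d \<ge> 1"
    and "\<And>\<sigma>. order_function f \<sigma> = order_function f (1 - \<sigma>) + d * (1/2 - \<sigma>)"
    and "\<And>\<sigma>. \<sigma> \<ge> 1 \<Longrightarrow> order_function f \<sigma> = 0"
    and "\<not> order_function f differentiable (at (1/2))"
  shows "lindelof_hypothesis f \<longleftrightarrow> approx_concave f"
proof
  have hol: "f holomorphic_on {z. Im z > 0}"
    using assms(1) by (rule analytic_imp_holomorphic)
  note poly = assms(2) and fe = assms(4) and zero = assms(5)
  have d: "d > 0" using assms(3) by simp
  {
    assume "lindelof_hypothesis f"
    hence right: "order_function f \<sigma> = 0" if "\<sigma> \<ge> 1/2" for \<sigma>
      using that by (simp add: lindelof_hypothesis_def is_order_threshold_def)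
    show "approx_concave f"
    proof (rule approx_concave_of_linear_order[OF hol poly d _ right])
      fix \<sigma> :: real assume "\<sigma> \<le> 1/2"
      thus "order_function f \<sigma> = d * (1/2 - \<sigma>)"
        using fe[of \<sigma>] right[of "1 - \<sigma>"] by simp
    qed
  next
    assume conc: "approx_concave f"
    have "\<not> order_function f (1/2) > 0"
      using order_function_differentiable_of_approx_concave[OF hol poly d fe zero conc] assms(6)
      by (auto simp: real_differentiable_def)
    hence half: "order_function f (1/2) = 0"
      using order_function_nonneg[OF poly, of "1/2"] by simp
    \<comment> \<open>A positive value to the right of 1/2 would, by strict decrease, force a
      positive value at 1/2.\<close>
    have "order_function f \<sigma> = 0" if "\<sigma> \<ge> 1/2" for \<sigma>
      using order_function_strict_decreasing[OF hol poly zero, of "1/2" \<sigma>]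
        order_function_nonneg[OF poly, of \<sigma>] half that
      by (cases "\<sigma> = 1/2") force+
    \<comment> \<open>To the left of 1/2 the functional equation adds the positive term
      \<open>d * (1/2 - \<sigma>)\<close> to a nonnegative order.\<close>
    moreover have "order_function f \<sigma> > 0" if "\<sigma> < 1/2" for \<sigma>
      using fe[of \<sigma>] order_function_nonneg[OF poly, of "1 - \<sigma>"] d that
      by (simp add: add_nonneg_pos)
    ultimately show "lindelof_hypothesis f"
      by (simp add: lindelof_hypothesis_def is_order_threshold_def)
  }
qed

end
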